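(* For every integer $n$ greater than $5$, there is a metric space on $n$ points where each closure-line consists of at most $n-2$ points and there are precisely $7$ distinct closure-lines altogether.
   Context: A hypergraph is an ordered pair $(X,H)$ such that $X$ is a set (of vertices) and $H$ is a family of subsets of $X$ (edges). A set $T$ of vertices in a hypergraph is called affinely closed if, and only if, every edge that shares at least two vertices with $T$ is fully contained in $T$. For every set $S$ of vertices, the affine closure $\mathrm{aff}(S)$ is the intersection of all affinely closed supersets of $S$ (it is itself affinely closed). The closure-lines in the hypergraph are all the sets $\mathrm{aff}(\{u,v\})$ with $u$ and $v$ two distinct vertices. For a metric space $(X,\rho)$, write $[abc]$ to mean that $a,b,c$ are three distinct points of $X$ and $\rho(a,b)+\rho(b,c)=\rho(a,c)$. The hypergraph associated with $(X,\rho)$ is $(X,H(\rho))$ with $H(\rho)=\{\{a,b,c\}:\,[abc]\}$. The closure-lines in the metric space $(X,\rho)$ are the closure-lines in the hypergraph $(X,H(\rho))$. *)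

theory Defs
  imports "HOL-Analysis.Analysis"
begin

definition hypergraph :: "'a set \<Rightarrow> 'a set set \<Rightarrow> bool" where
  "hypergraph X H \<longleftrightarrow> (\<forall>E\<in>H. E \<subseteq> X)"

definition affinely_closed :: "'a set \<Rightarrow> 'a set set \<Rightarrow> 'a set \<Rightarrow> bool" where
  "affinely_closed X H T \<longleftrightarrow>
     T \<subseteq> X \<and> (\<forall>E\<in>H. (\<exists>u\<in>E \<inter> T. \<exists>v\<in>E \<inter> T. u \<noteq> v) \<longrightarrow> E \<subseteq> T)"

text \<open>For a hypergraph and \<open>S \<subseteq> X\<close>, the family below contains \<open>X\<close>, so the intersection
  is never the intersection of an empty family.\<close>

definition aff :: "'a set \<Rightarrow> 'a set set \<Rightarrow> 'a set \<Rightarrow> 'a set" where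
  "aff X H S = \<Inter>{T. affinely_closed X H T \<and> S \<subseteq> T}"

definition closure_lines :: "'a set \<Rightarrow> 'a set set \<Rightarrow> 'a set set" where
  "closure_lines X H = {aff X H {u, v} | u v. u \<in> X \<and> v \<in> X \<and> u \<noteq> v}"

definition metric_between :: "'a set \<Rightarrow> ('a \<Rightarrow> 'a \<Rightarrow> real) \<Rightarrow> 'a \<Rightarrow> 'a \<Rightarrow> 'a \<Rightarrow> bool" where
  "metric_between X \<rho> a b c \<longleftrightarrow>
     a \<in> X \<and> b \<in> X \<and> c \<in> X \<and> a \<noteq> b \<and> b \<noteq> c \<and> a \<noteq> c \<and> \<rho> a b + \<rho> b c = \<rho> a c"

definition metric_edges :: "'a set \<Rightarrow> ('a \<Rightarrow> 'a \<Rightarrow> real) \<Rightarrow> 'a set set" where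
  "metric_edges X \<rho> = {{a, b, c} | a b c. metric_between X \<rho> a b c}"

definition metric_closure_lines :: "'a set \<Rightarrow> ('a \<Rightarrow> 'a \<Rightarrow> real) \<Rightarrow> 'a set set" where
  "metric_closure_lines X \<rho> = closure_lines X (metric_edges X \<rho>)"

lemma hypergraph_metric_edges: "hypergraph X (metric_edges X \<rho>)"
  by (auto simp: hypergraph_def metric_edges_def metric_between_def)

lemma affinely_closed_carrier: "hypergraph X H \<Longrightarrow> affinely_closed X H X"
  by (auto simp: hypergraph_def affinely_closed_def)

lemma affinely_closed_aff:
  assumes "hypergraph X H" and "S \<subseteq> X"
  shows "affinely_closed X H (aff X H S)"
  unfolding affinely_closed_def
proof (intro conjI ballI impI)
  show "aff X H S \<subseteq> X"
    unfolding aff_def using affinely_closed_carrier[OF assms(1)] assms(2) by (intro Inter_lower) simp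
next
  fix E assume E: "E \<in> H" and "\<exists>u\<in>E \<inter> aff X H S. \<exists>v\<in>E \<inter> aff X H S. u \<noteq> v"
  then obtain u v where uv: "u \<in> E" "v \<in> E" "u \<in> aff X H S" "v \<in> aff X H S" "u \<noteq> v"
    by auto
  have "E \<subseteq> T" if T: "affinely_closed X H T" "S \<subseteq> T" for T
  proof -
    have "u \<in> T" "v \<in> T"
      using uv(3,4) T by (simp_all add: aff_def)
    then have "u \<in> E \<inter> T" "v \<in> E \<inter> T"
      using uv(1,2) by simp_all
    then show ?thesis
      using T(1) E uv(5) unfolding affinely_closed_def by metis
  qed
  then show "E \<subseteq> aff X H S"
    unfolding aff_def by (intro Inter_greatest) simp
qed

end

theory Submission
  imports Defs
begin

text \<open>Take \<open>n - 4\<close> points \<open>4, \<dots>, n - 1\<close> on a short geodesic \<open>A\<close> and two antipodal pairs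
  \<open>{0, 1}\<close> and \<open>{2, 3}\<close>, each of which has every point of \<open>A\<close> as a midpoint; the distances
  between the two pairs are chosen so that no further triple is collinear. Then \<open>A\<close>,
  \<open>A \<union> {0, 1}\<close> and \<open>A \<union> {2, 3}\<close> are closure-lines, and the only others are the four
  two-point sets joining one antipodal pair to the other.\<close>

section \<open>Edges and affine closures in general\<close>

lemma metric_edgesI:
  "metric_between X \<rho> a b c \<Longrightarrow> {a, b, c} \<in> metric_edges X \<rho>"
  unfolding metric_edges_def by blast

lemma closure_linesI:
  "u \<in> X \<Longrightarrow> v \<in> X \<Longrightarrow> u \<noteq> v \<Longrightarrow> aff X H {u, v} \<in> closure_lines X H"
  unfolding closure_lines_def by blast

lemma aff_eqI:
  assumes "affinely_closed X H T" "S \<subseteq> T"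
    and "\<And>T'. affinely_closed X H T' \<Longrightarrow> S \<subseteq> T' \<Longrightarrow> T \<subseteq> T'"
  shows "aff X H S = T"
  using assms unfolding aff_def by blast

lemma affinely_closedI:
  assumes "T \<subseteq> X"
    and "\<And>E u v. E \<in> H \<Longrightarrow> u \<in> E \<Longrightarrow> v \<in> E \<Longrightarrow> u \<in> T \<Longrightarrow> v \<in> T \<Longrightarrow> u \<noteq> v \<Longrightarrow> E \<subseteq> T"
  shows "affinely_closed X H T"
  using assms unfolding affinely_closed_def by blast

lemma affinely_closed_edge:
  assumes "affinely_closed X H T" "E \<in> H" "u \<in> E" "v \<in> E" "u \<in> T" "v \<in> T" "u \<noteq> v"
  shows "E \<subseteq> T"
  using assms unfolding affinely_closed_def by blast

section \<open>The metric and its collinear triples\<close>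

text \<open>The scale \<open>n\<close> exceeds every distance inside the geodesic. The values
  \<open>2n\<close> and \<open>4n\<close> make each geodesic point a midpoint of each antipodal
  pair, while \<open>3n\<close> across the pairs is neither \<open>4n\<close> nor a sum of two other
  distances that occur. The test \<open>i < 2 \<longleftrightarrow> j < 2\<close> is reached only
  for indices below 4, where it means "same pair".\<close>

definition seven_dist :: "nat \<Rightarrow> nat \<Rightarrow> nat \<Rightarrow> real" where
  "seven_dist n i j =
    (if i = j then 0
     else if 4 \<le> i \<and> 4 \<le> j then \<bar>real i - real j\<bar>
     else if 4 \<le> i \<or> 4 \<le> j then 2 * real n
     else if i < 2 \<longleftrightarrow> j < 2 then 4 * real n
     else 3 * real n)"

lemma seven_dist_sym: "seven_dist n i j = seven_dist n j i"
  by (auto simp: seven_dist_def)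

lemma Metric_space_seven_dist: "Metric_space {..<n} (seven_dist n)"
proof
  show "0 \<le> seven_dist n x y" for x y
    by (auto simp: seven_dist_def)
  show "seven_dist n x y = seven_dist n y x" for x y
    by (rule seven_dist_sym)
  show "seven_dist n x y = 0 \<longleftrightarrow> x = y" if "x \<in> {..<n}" "y \<in> {..<n}" for x y
    using that by (auto simp: seven_dist_def)
  show "seven_dist n x z \<le> seven_dist n x y + seven_dist n y z"
    if "x \<in> {..<n}" "y \<in> {..<n}" "z \<in> {..<n}" for x y z
    \<comment> \<open>The bound by \<open>n\<close> matters when \<open>x\<close> and
      \<open>z\<close> lie on the geodesic and \<open>y\<close> does not: then the claim is |x - z|
      \<le> 4n.\<close>
    using that by (cases "4 \<le> x"; cases "4 \<le> y"; cases "4 \<le> z") (auto simp: seven_dist_def)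
qed

lemma seven_dist_simps:
  "4 \<le> i \<Longrightarrow> 4 \<le> j \<Longrightarrow> seven_dist n i j = \<bar>real i - real j\<bar>"
  "4 \<le> i \<Longrightarrow> \<not> 4 \<le> j \<Longrightarrow> seven_dist n i j = 2 * real n"
  "\<not> 4 \<le> i \<Longrightarrow> 4 \<le> j \<Longrightarrow> seven_dist n i j = 2 * real n"
  by (auto simp: seven_dist_def)

lemma seven_dist_less_4:
  assumes "\<not> 4 \<le> i" "\<not> 4 \<le> j" "i \<noteq> j"
  shows "seven_dist n i j = 4 * real n \<and> (i < 2 \<longleftrightarrow> j < 2) \<or> seven_dist n i j = 3 * real n"
  using assms by (auto simp: seven_dist_def)

text \<open>A middle point below 4 makes the triangle inequality strict. A middle point on the
  geodesic with exactly one end there would coincide with that end. With both ends below 4 the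
  equation reads 2n + 2n = 4n, which only the two antipodal pairs satisfy.\<close>

lemma metric_between_seven_dist_cases:
  assumes "metric_between {..<n} (seven_dist n) a b c"
  shows "4 \<le> a \<and> 4 \<le> b \<and> 4 \<le> c \<or>
    4 \<le> b \<and> ({a, c} = {0, 1} \<or> {a, c} = {2, 3})"
proof -
  have less: "real a < n" "real c < n"
    and ne: "real a \<noteq> real b" "real b \<noteq> real c" "a \<noteq> b" "b \<noteq> c" "a \<noteq> c"
    and eq: "seven_dist n a b + seven_dist n b c = seven_dist n a c"
    using assms by (auto simp: metric_between_def)
  have pos: "0 < real n" "0 \<le> real a" "0 \<le> real c"
    using less(1) by auto
  have pair: "{a, c} = {0, 1} \<or> {a, c} = {2, 3}"
    if "\<not> 4 \<le> a" "\<not> 4 \<le> c" "a < 2 \<longleftrightarrow> c < 2"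
  proof -
    have "a = 0 \<or> a = 1 \<or> a = 2 \<or> a = 3" "c = 0 \<or> c = 1 \<or> c = 2 \<or> c = 3"
      using that(1,2) by presburger+
    then show ?thesis
      using that(3) ne(5) by (elim disjE) (simp_all add: insert_commute)
  qed
  have "4 \<le> a \<and> 4 \<le> b \<and> 4 \<le> c \<or> 4 \<le> b \<and> \<not> 4 \<le> a \<and> \<not> 4 \<le> c \<and> (a < 2 \<longleftrightarrow> c < 2)"
  proof (cases "4 \<le> b")
    case True
    then show ?thesis
    proof (cases "4 \<le> a"; cases "4 \<le> c")
      assume "4 \<le> a" "4 \<le> c"
      then show ?thesis using True by simp
    next
      assume "4 \<le> a" "\<not> 4 \<le> c"
      then have "real a = real b"
        using eq True by (simp add: seven_dist_simps)
      with ne(1) show ?thesis by simp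
    next
      assume "\<not> 4 \<le> a" "4 \<le> c"
      then have "real b = real c"
        using eq True by (simp add: seven_dist_simps)
      with ne(2) show ?thesis by simp
    next
      assume ac: "\<not> 4 \<le> a" "\<not> 4 \<le> c"
      then have "seven_dist n a c = 4 * real n"
        using eq True by (simp add: seven_dist_simps)
      then show ?thesis
        using seven_dist_less_4[OF ac ne(5), of n] pos(1) True ac by auto
    qed
  next
    case False
    \<comment> \<open>With a middle point below 4, these bounds leave 4n against less than n, at
      least 5n against 2n, or at least 6n against at most 4n, according to where the ends
      lie.\<close>
    have low: "3 * real n \<le> seven_dist n i j" "seven_dist n i j \<le> 4 * real n"
      if "\<not> 4 \<le> i" "\<not> 4 \<le> j" "i \<noteq> j" for i j
      using seven_dist_less_4[OF that, of n] pos(1) by linarith+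
    have "seven_dist n a c < seven_dist n a b + seven_dist n b c"
    proof (cases "4 \<le> a"; cases "4 \<le> c")
      assume "4 \<le> a" "4 \<le> c"
      then show ?thesis using False less pos by (simp add: seven_dist_simps)
    next
      assume "4 \<le> a" "\<not> 4 \<le> c"
      then show ?thesis using False low(1)[of b c] ne(4) pos(1) by (simp add: seven_dist_simps)
    next
      assume "\<not> 4 \<le> a" "4 \<le> c"
      then show ?thesis using False low(1)[of a b] ne(3) pos(1) by (simp add: seven_dist_simps)
    next
      assume "\<not> 4 \<le> a" "\<not> 4 \<le> c"
      then show ?thesis
        using low(1)[of a b] low(1)[of b c] low(2)[of a c] False ne(3-5) pos(1) by simp
    qed
    then show ?thesis using eq by simp
  qed
  then show ?thesis
    by (elim disjE conjE) (use pair in simp_all)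
qed

section \<open>Edges and affinely closed sets of the resulting hypergraph\<close>

context
  fixes n :: nat and H :: "nat set set"
  assumes n: "5 < n"
  defines "H \<equiv> metric_edges {..<n} (seven_dist n)"
begin

lemma edge_cases:
  assumes "E \<in> H"
  obtains a b c where "E = {a, b, c}" "4 \<le> a" "4 \<le> b" "4 \<le> c" "a < n" "b < n" "c < n"
  | a where "E = {0, 1, a}" "4 \<le> a" "a < n"
  | a where "E = {2, 3, a}" "4 \<le> a" "a < n"
proof -
  obtain a b c where E: "E = {a, b, c}" and abc: "metric_between {..<n} (seven_dist n) a b c"
    using assms unfolding H_def metric_edges_def by blast
  have less: "a < n" "b < n" "c < n"
    using abc by (simp_all add: metric_between_def)
  have E': "E = insert b {a, c}"
    using E by (simp add: insert_commute)
  consider "4 \<le> a" "4 \<le> b" "4 \<le> c" | "4 \<le> b" "{a, c} = {0, 1}" | "4 \<le> b" "{a, c} = {2, 3}"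
    using metric_between_seven_dist_cases[OF abc] by metis
  then show ?thesis
  proof cases
    case 1
    then show ?thesis using that(1)[OF E] less by simp
  next
    case 2
    then show ?thesis using that(2)[of b] less E' by (simp add: insert_commute)
  next
    case 3
    then show ?thesis using that(3)[of b] less E' by (simp add: insert_commute)
  qed
qed

text \<open>Writing a pair as \<open>{p, Suc p}\<close> with \<open>p\<close> equal to 0 or 2 lets
  one argument serve both antipodal pairs.\<close>

lemma pair_edge:
  assumes "p = 0 \<or> p = 2" "4 \<le> a" "a < n"
  shows "{p, Suc p, a} \<in> H"
proof -
  have "metric_between {..<n} (seven_dist n) p a (Suc p)"
    using assms by (auto simp: metric_between_def seven_dist_def)
  then have "{p, a, Suc p} \<in> H"
    unfolding H_def by (rule metric_edgesI)
  moreover have "{p, a, Suc p} = {p, Suc p, a}"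
    by (simp add: insert_commute)
  ultimately show ?thesis
    by metis
qed

lemma geodesic_edge:
  assumes "4 \<le> a" "a < b" "b < c" "c < n"
  shows "{a, b, c} \<in> H"
  unfolding H_def using assms
  by (intro metric_edgesI) (simp add: metric_between_def seven_dist_simps)

text \<open>An edge through an antipodal pair has only one point on the geodesic.\<close>

lemma affinely_closed_geodesic: "affinely_closed {..<n} H {4..<n}"
proof (rule affinely_closedI)
  show "E \<subseteq> {4..<n}" if "E \<in> H" "x \<in> E" "y \<in> E"
    "x \<in> {4..<n}" "y \<in> {4..<n}" "x \<noteq> y" for E x y
    using that(1) by (cases rule: edge_cases) (use that(2-) n in auto)
qed (use n in auto)

text \<open>An edge through the other pair meets this set in a single geodesic point.\<close>

lemma affinely_closed_geodesic_pair:
  assumes "p = 0 \<or> p = 2"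
  shows "affinely_closed {..<n} H ({p, Suc p} \<union> {4..<n})"
proof (rule affinely_closedI)
  show "E \<subseteq> {p, Suc p} \<union> {4..<n}" if "E \<in> H" "x \<in> E" "y \<in> E"
    "x \<in> {p, Suc p} \<union> {4..<n}" "y \<in> {p, Suc p} \<union> {4..<n}" "x \<noteq> y" for E x y
    using that(1) by (cases rule: edge_cases) (use that(2-) assms in auto)
qed (use n assms in auto)

text \<open>No edge meets both antipodal pairs, so the closure condition holds vacuously.\<close>

lemma affinely_closed_cross:
  assumes "u < 2" "2 \<le> v" "v < 4"
  shows "affinely_closed {..<n} H {u, v}"
proof (rule affinely_closedI)
  show "E \<subseteq> {u, v}" if "E \<in> H" "x \<in> E" "y \<in> E"
    "x \<in> {u, v}" "y \<in> {u, v}" "x \<noteq> y" for E x y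
    using that(1) by (cases rule: edge_cases) (use that(2-) assms in auto)
qed (use n assms in auto)

text \<open>Any third geodesic point forms an edge with \<open>a\<close> and \<open>b\<close>; only
  its position relative to them varies.\<close>

lemma geodesic_subset_closed:
  assumes T: "affinely_closed {..<n} H T"
    and ab: "a \<in> T" "b \<in> T" "a < b" "4 \<le> a" "b < n"
  shows "{4..<n} \<subseteq> T"
proof
  fix c assume c: "c \<in> {4..<n}"
  \<comment> \<open>\<open>geodesic_edge\<close> expects increasing order, so the edge is passed as
    a sorted triple equal to \<open>{a, b, c}\<close>.\<close>
  have mem: "c \<in> T" if "{x, y, z} \<in> H" "{a, b, c} = {x, y, z}" for x y z
  proof -
    have "{a, b, c} \<in> H" using that by simp
    from affinely_closed_edge[OF T this, of a b] show ?thesis using ab by simp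
  qed
  consider "c < a" | "c = a" | "a < c" "c < b" | "c = b" | "b < c"
    by (meson linorder_neqE_nat)
  then show "c \<in> T"
  proof cases
    case 1
    with c ab show ?thesis
      by (intro mem[OF geodesic_edge[of c a b]]) auto
  next
    case 3
    with c ab show ?thesis
      by (intro mem[OF geodesic_edge[of a c b]]) auto
  next
    case 5
    with c ab show ?thesis
      by (intro mem[OF geodesic_edge[of a b c]]) auto
  qed (use ab in simp_all)
qed

text \<open>One point of the pair and one of the geodesic generate the rest of the pair; the whole
  pair then generates every geodesic point.\<close>

lemma geodesic_pair_subset_closed:
  assumes p: "p = 0 \<or> p = 2" and T: "affinely_closed {..<n} H T"
    and uv: "u \<in> {p, Suc p}" "v \<in> {p, Suc p} \<union> {4..<n}" "u \<in> T" "v \<in> T" "u \<noteq> v"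
  shows "{p, Suc p} \<union> {4..<n} \<subseteq> T"
proof -
  have pair: "{p, Suc p} \<subseteq> T"
  proof (cases "v \<in> {p, Suc p}")
    case True
    then show ?thesis using uv by auto
  next
    case False
    then show ?thesis
      using affinely_closed_edge[OF T pair_edge[OF p, of v], of u v] uv by auto
  qed
  have "a \<in> T" if "a \<in> {4..<n}" for a
    using affinely_closed_edge[OF T pair_edge[OF p, of a], of p "Suc p"] that pair by auto
  with pair show ?thesis by blast
qed

section \<open>Determination of the closure-lines\<close>

lemma aff_geodesic:
  assumes "a \<in> {4..<n}" "b \<in> {4..<n}" "a < b"
  shows "aff {..<n} H {a, b} = {4..<n}"
proof (rule aff_eqI[OF affinely_closed_geodesic])
  show "{4..<n} \<subseteq> T" if "affinely_closed {..<n} H T" "{a, b} \<subseteq> T" for T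
    using geodesic_subset_closed[OF that(1), of a b] that(2) assms by auto
qed (use assms in auto)

lemma aff_geodesic_pair:
  assumes "p = 0 \<or> p = 2" "u \<in> {p, Suc p}" "v \<in> {p, Suc p} \<union> {4..<n}" "u \<noteq> v"
  shows "aff {..<n} H {u, v} = {p, Suc p} \<union> {4..<n}"
proof (rule aff_eqI[OF affinely_closed_geodesic_pair[OF assms(1)]])
  show "{p, Suc p} \<union> {4..<n} \<subseteq> T" if "affinely_closed {..<n} H T" "{u, v} \<subseteq> T" for T
    using geodesic_pair_subset_closed[OF assms(1) that(1) assms(2,3)] that(2) assms(4) by auto
qed (use assms in auto)

lemma aff_cross:
  assumes "u < 2" "2 \<le> v" "v < 4"
  shows "aff {..<n} H {u, v} = {u, v}"
  by (rule aff_eqI[OF affinely_closed_cross[OF assms]]) auto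

lemma closure_lines_seven:
  "closure_lines {..<n} H =
    {{4..<n}, {0, 1} \<union> {4..<n}, {2, 3} \<union> {4..<n}, {0, 2}, {0, 3}, {1, 2}, {1, 3}}"
  (is "_ = ?L")
proof
  \<comment> \<open>Since \<open>{u, v}\<close> is unordered, it suffices to treat
    \<open>u < v\<close>; then 2 \<le> u < 4 forces \<open>v\<close> to be 3 or a geodesic
    point.\<close>
  have "aff {..<n} H {u, v} \<in> ?L" if "u < v" "v < n" for u v
  proof -
    consider "4 \<le> u" | "u < 2" "v < 2 \<or> 4 \<le> v" | "u < 2" "2 \<le> v" "v < 4" | "2 \<le> u" "u < 4"
      using not_le by blast
    then show ?thesis
    proof cases
      case 1
      then have "aff {..<n} H {u, v} = {4..<n}"
        using that by (intro aff_geodesic) auto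
      then show ?thesis by simp
    next
      case 2
      then have "u \<in> {0, Suc 0}" "v \<in> {0, Suc 0} \<union> {4..<n}"
        using that by auto
      then have "aff {..<n} H {u, v} = {0, Suc 0} \<union> {4..<n}"
        using that by (intro aff_geodesic_pair) auto
      then show ?thesis by simp
    next
      case 3
      then have "u = 0 \<or> u = 1" "v = 2 \<or> v = 3" by auto
      then show ?thesis unfolding aff_cross[OF 3] by (elim disjE) simp_all
    next
      case 4
      then have "u \<in> {2, Suc 2}" "v \<in> {2, Suc 2} \<union> {4..<n}"
        using that by auto
      then have "aff {..<n} H {u, v} = {2, Suc 2} \<union> {4..<n}"
        using that by (intro aff_geodesic_pair) auto
      moreover have "Suc 2 = 3" by simp
      ultimately have "aff {..<n} H {u, v} = {2, 3} \<union> {4..<n}" by simp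
      then show ?thesis by simp
    qed
  qed
  note aff_mem = this
  show "closure_lines {..<n} H \<subseteq> ?L"
  proof
    fix L assume "L \<in> closure_lines {..<n} H"
    then obtain u v where L: "L = aff {..<n} H {u, v}" and uv: "u < n" "v < n" "u \<noteq> v"
      by (auto simp: closure_lines_def)
    show "L \<in> ?L"
    proof (cases "u < v")
      case True
      show ?thesis unfolding L by (rule aff_mem[OF True uv(2)])
    next
      case False
      then have "v < u" using uv(3) by simp
      moreover have "{u, v} = {v, u}" by (rule insert_commute)
      ultimately show ?thesis unfolding L using aff_mem[of v u] uv(1) by (simp only:)
    qed
  qed
  have line: "aff {..<n} H {u, v} \<in> closure_lines {..<n} H" if "u < n" "v < n" "u \<noteq> v" for u v
    using that by (intro closure_linesI) simp_all
  \<comment> \<open>The hypothesis n > 5 puts both 4 and 5 among the points, so the geodesic is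
    itself a line.\<close>
  have "{4..<n} \<in> closure_lines {..<n} H"
    using line[of 4 5] aff_geodesic[of 4 5] n by simp
  moreover have "{0, 1} \<union> {4..<n} \<in> closure_lines {..<n} H"
    using line[of 0 1] aff_geodesic_pair[of 0 0 1] n by simp
  moreover have "{2, 3} \<union> {4..<n} \<in> closure_lines {..<n} H"
    using line[of 2 3] aff_geodesic_pair[of 2 2 3] n by simp
  moreover have "{u, v} \<in> closure_lines {..<n} H" if "u < 2" "2 \<le> v" "v < 4" for u v
    using line[of u v] aff_cross[OF that] that n by simp
  then have "{0, 2} \<in> closure_lines {..<n} H" "{0, 3} \<in> closure_lines {..<n} H"
    "{1, 2} \<in> closure_lines {..<n} H" "{1, 3} \<in> closure_lines {..<n} H"
    by simp_all
  ultimately show "?L \<subseteq> closure_lines {..<n} H"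
    by (simp only: insert_subset empty_subsetI simp_thms)
qed

section \<open>Number and size of the closure-lines\<close>

lemma card_closure_lines_seven: "card (closure_lines {..<n} H) = 7"
proof -
  define L0 L1 L2 P where defs: "L0 = {4..<n}" "L1 = {0, 1} \<union> {4..<n}" "L2 = {2, 3} \<union> {4..<n}"
    "P = {{0, 2}, {0, 3}, {1, 2}, {1, 3 :: nat}}"
  \<comment> \<open>The points 0 and 2 tell the three long lines apart; the point 4 separates them
    from the doubletons in \<open>P\<close>.\<close>
  have "0 \<notin> L0" "0 \<in> L1" "0 \<notin> L2" "2 \<notin> L0" "2 \<in> L2"
    by (simp_all add: defs)
  then have "L0 \<noteq> L1" "L0 \<noteq> L2" "L1 \<noteq> L2"
    by blast+
  moreover have "4 \<in> L0" "4 \<in> L1" "4 \<in> L2"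
    using n by (simp_all add: defs)
  moreover have "4 \<notin> L" if "L \<in> P" for L
    using that by (auto simp: defs)
  ultimately have "L0 \<notin> insert L1 (insert L2 P)" "L1 \<notin> insert L2 P" "L2 \<notin> P"
    by blast+
  moreover have "finite P" "card P = 4"
    by (simp_all add: defs doubleton_eq_iff)
  moreover have "closure_lines {..<n} H = insert L0 (insert L1 (insert L2 P))"
    unfolding closure_lines_seven defs by (rule refl)
  ultimately show ?thesis
    by simp
qed

lemma card_closure_line_le:
  assumes "L \<in> closure_lines {..<n} H"
  shows "card L \<le> n - 2"
proof -
  \<comment> \<open>The geodesic has n - 4 points, so a pair adds up to at most n - 2. The
    doubletons fit because 2 \<le> n - 2.\<close>
  have "card ({p, q} \<union> {4..<n}) \<le> n - 2" for p q
    using card_Un_le[of "{p, q}" "{4..<n}"] card_insert_le_m1[of 2 "{q}" p] n by simp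
  then show ?thesis
    using assms n unfolding closure_lines_seven by (auto simp del: Un_insert_left)
qed

end

theorem theorem7:
  fixes n :: nat
  assumes "n > 5"
  shows "\<exists>(X :: nat set) \<rho>. Metric_space X \<rho> \<and> finite X \<and> card X = n \<and>
           (\<forall>L \<in> metric_closure_lines X \<rho>. card L \<le> n - 2) \<and>
           card (metric_closure_lines X \<rho>) = 7"
proof (intro exI conjI ballI)
  show "Metric_space {..<n} (seven_dist n)"
    by (rule Metric_space_seven_dist)
  show "card L \<le> n - 2" if "L \<in> metric_closure_lines {..<n} (seven_dist n)" for L
    using card_closure_line_le[OF assms] that unfolding metric_closure_lines_def .
  show "card (metric_closure_lines {..<n} (seven_dist n)) = 7"
    using card_closure_lines_seven[OF assms] unfolding metric_closure_lines_def .
qed simp_all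

end
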